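(* Let $\Omega\subseteq\mathbb{R}^N$ be Lebesgue measurable with $|\Omega|<\infty$ and let $T>0$ be fixed. Then for every $s\in\mathbb{C}$ such that $\operatorname{Re} s>\overline{\dim}_B(\infty,\Omega)$ it holds that $$\int_{{}_T\Omega}|x|^{-s-N}\,dx=T^{-s-N}\,|{}_T\Omega|-(s+N)\int_T^{+\infty}t^{-s-N-1}\,|{}_t\Omega|\,dt,$$ i.e., the functional equation $$\zeta_{\infty,\Omega}(s;T)=T^{-s-N}\,|{}_T\Omega|-(s+N)\,\widetilde{\zeta}_{\infty,\Omega}(s;T)$$ holds.
   Context: $|\cdot|$ denotes the Euclidean norm of a vector in $\mathbb{R}^N$ and the $N$-dimensional Lebesgue measure of a set. For $t>0$, ${}_t\Omega:=B_t(0)^c\cap\Omega$, where $B_t(0)$ is the open Euclidean ball of radius $t$ centered at $0$ and $^c$ is the complement in $\mathbb{R}^N$. For $r\in\mathbb{R}$, the upper $r$-dimensional Minkowski content of $\Omega$ at infinity is $\overline{\mathcal M}^r(\infty,\Omega):=\limsup_{t\to+\infty}|{}_t\Omega|/t^{N+r}$, and the upper Minkowski (box) dimension of $\Omega$ at infinity is $\overline{\dim}_B(\infty,\Omega):=\inf\{r\in\mathbb{R}:\overline{\mathcal M}^r(\infty,\Omega)=0\}\in[-\infty,-N]$. The distance zeta function at infinity is $\zeta_{\infty,\Omega}(s;T):=\int_{{}_T\Omega}|x|^{-s-N}\,dx$ and the tube zeta function at infinity is $\widetilde\zeta_{\infty,\Omega}(s;T):=\int_T^{+\infty}t^{-s-N-1}|{}_t\Omega|\,dt$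 (Lebesgue integrals, for $\operatorname{Re}s$ sufficiently large). *)

theory Defs
  imports "HOL-Analysis.Analysis"
begin

definition tail :: "real \<Rightarrow> (real ^ 'n::finite) set \<Rightarrow> (real ^ 'n) set" where
  "tail t \<Omega> = - ball 0 t \<inter> \<Omega>"

(* Values are extended nonnegative reals, so the content is meaningful (possibly infinite)
   also when some tail of the set has infinite measure. *)
definition upper_minkowski_content_at_infinity ::
    "real \<Rightarrow> (real ^ 'n::finite) set \<Rightarrow> ennreal" where
  "upper_minkowski_content_at_infinity r \<Omega> =
     Limsup at_top (\<lambda>t::real. emeasure lebesgue (tail t \<Omega>) / ennreal (t powr (real CARD('n) + r)))"

definition upper_box_dim_at_infinity :: "(real ^ 'n::finite) set \<Rightarrow> ereal" where
  "upper_box_dim_at_infinity \<Omega> =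
     Inf {ereal r | r. upper_minkowski_content_at_infinity r \<Omega> = 0}"

(* The Bochner integral is 0 for non-integrable integrands, so the two zeta functions carry their
   meaning only together with integrability. *)
definition distance_zeta_at_infinity ::
    "(real ^ 'n::finite) set \<Rightarrow> real \<Rightarrow> complex \<Rightarrow> complex" where
  "distance_zeta_at_infinity \<Omega> T s =
     (LINT x : tail T \<Omega> | lebesgue. complex_of_real (norm x) powr (- s - of_nat CARD('n)))"

definition tube_zeta_at_infinity ::
    "(real ^ 'n::finite) set \<Rightarrow> real \<Rightarrow> complex \<Rightarrow> complex" where
  "tube_zeta_at_infinity \<Omega> T s =
     (LINT t : {T<..} | lebesgue.
        complex_of_real t powr (- s - of_nat CARD('n) - 1) *
        complex_of_real (measure lebesgue (tail t \<Omega>)))"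

end

theory Submission
  imports Defs
begin

text \<open>
  Write \<open>w = - s - N\<close> and \<open>V t\<close> for the measure of the part of \<open>\<Omega>\<close> at distance at least \<open>t\<close>
  from the origin.  The functional equation is integration by parts in layer-cake form: for
  \<open>c \<ge> T\<close>, the power \<open>c powr w\<close> equals \<open>T powr w\<close> plus the integral of \<open>w * t powr (w - 1)\<close> over
  \<open>T < t \<le> c\<close>.  With \<open>c = norm x\<close>, integrating over the tail and interchanging the integrals
  collects, for each \<open>t\<close>, the points with \<open>norm x \<ge> t\<close>, whose measure is \<open>V t\<close>.
  This interchange is a statement about any measurable function bounded below by \<open>T\<close> on a finite
  measure space (\<open>moment_eq_integral_tail_measure\<close>).

  The dimension hypothesis enters only through absolute convergence.  It supplies some
  \<open>r < Re s\<close> at which the upper content vanishes, hence a bound \<open>V t \<le> C * t powr (N + r)\<close> on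
  all of \<open>t > T\<close> (\<open>tail_measure_powr_bound\<close>).  The tube integrand is then dominated by
  a multiple of \<open>t powr (r - Re s - 1)\<close>, whose exponent is below \<open>- 1\<close>
  (\<open>set_integrable_powr_mult_of_bound\<close>).  That same integral of absolute values is what Tonelli
  requires, so integrability of \<open>norm x powr w\<close> on the tail comes out of the interchange too.
\<close>

section \<open>Complex powers on a half-line\<close>

lemma continuous_on_of_real_powr:
  fixes w :: complex
  assumes "S \<subseteq> {0<..}"
  shows "continuous_on S (\<lambda>t. complex_of_real t powr w)"
  using assms by (intro continuous_intros) (auto simp: complex_nonpos_Reals_iff)

lemma borel_measurable_indicator_of_real_powr:
  fixes w :: complex and T :: real
  assumes "T > 0"
  shows "(\<lambda>t. indicator {T<..} t *\<^sub>R (complex_of_real t powr w)) \<in> borel_measurable borel"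
  using assms by (intro borel_measurable_continuous_on_indicator continuous_on_of_real_powr) auto

lemma of_real_powr_FTC:
  fixes w :: complex and T c :: real
  assumes "0 < T" "T \<le> c"
  shows "(LINT t:{T<..c}|lborel. w * complex_of_real t powr (w - 1))
           = complex_of_real c powr w - complex_of_real T powr w"
proof -
  let ?f = "\<lambda>t. w * complex_of_real t powr (w - 1)"
  have mm: "min T c = T" "max T c = c"
    using assms by auto
  have "(LBINT t=T..c. ?f t) = complex_of_real c powr w - complex_of_real T powr w"
  proof (rule interval_integral_FTC_finite; unfold mm)
    have "{T..c} \<subseteq> {0<..}"
      using assms by auto
    from continuous_on_mult_left[OF continuous_on_of_real_powr[OF this]]
    show "continuous_on {T..c} ?f" .
    fix t assume "T \<le> t"
    then have "t > 0" using assms by simp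
    then have "((\<lambda>z. z powr w) has_field_derivative ?f t) (at (complex_of_real t))"
      by (intro has_field_derivative_powr) (simp add: complex_nonpos_Reals_iff)
    from has_field_derivative_at_within[OF this] show "((\<lambda>t. complex_of_real t powr w) has_vector_derivative ?f t) (at t within {T..c})"
      by (rule has_vector_derivative_real_field)
  qed
  then show ?thesis
    using assms by (simp add: interval_integral_Ioc)
qed

lemma set_integrable_powr_mult_of_bound:
  fixes h :: "real \<Rightarrow> real" and T p :: real and w :: complex
  assumes "T > 0" and p: "p + Re w < 0"
    and h: "h \<in> borel_measurable borel" "\<And>t. 0 \<le> h t"
    and le: "\<And>t. t > T \<Longrightarrow> h t \<le> C * t powr p"
  shows "set_integrable lborel {T<..} (\<lambda>t. complex_of_real t powr (w - 1) * complex_of_real (h t))"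
proof -
  let ?e = "p + Re w - 1"
  have "(\<lambda>t. t powr ?e) integrable_on {T..}"
    using has_integral_powr_to_inf[of ?e T] p \<open>T > 0\<close> by (auto simp: integrable_on_def)
  then have "set_integrable lebesgue {T..} (\<lambda>t. t powr ?e)"
    by (rule nonnegative_absolutely_integrable_1) simp
  then have "set_integrable lborel {T..} (\<lambda>t. t powr ?e)"
    unfolding set_integrable_def by (subst (asm) integrable_completion) auto
  then have "set_integrable lborel {T<..} (\<lambda>t. t powr ?e)"
    by (rule set_integrable_subset) auto
  then have "set_integrable lborel {T<..} (\<lambda>t. C * t powr ?e)"
    by (rule set_integrable_mult_right)
  then show ?thesis
  proof (rule set_integrable_bound)
    have "(\<lambda>t. (indicator {T<..} t *\<^sub>R (complex_of_real t powr (w - 1))) * complex_of_real (h t))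
            \<in> borel_measurable borel"
      using borel_measurable_indicator_of_real_powr[OF \<open>T > 0\<close>] h by measurable
    then show "set_borel_measurable lborel {T<..}
        (\<lambda>t. complex_of_real t powr (w - 1) * complex_of_real (h t))"
      unfolding set_borel_measurable_def by simp
    have "norm (complex_of_real t powr (w - 1) * complex_of_real (h t)) \<le> norm (C * t powr ?e)"
      if "t > T" for t
    proof -
      have "norm (complex_of_real t powr (w - 1) * complex_of_real (h t)) = t powr (Re w - 1) * h t"
        using that \<open>T > 0\<close> h by (simp add: norm_mult norm_powr_real_powr)
      also have "\<dots> \<le> t powr (Re w - 1) * (C * t powr p)"
        using le[OF that] by (intro mult_left_mono) auto
      also have "\<dots> = C * t powr ?e"
        using that \<open>T > 0\<close> by (simp add: powr_add[symmetric] algebra_simps)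
      finally show ?thesis by simp
    qed
    then show "AE t in lborel. t \<in> {T<..} \<longrightarrow>
        norm (complex_of_real t powr (w - 1) * complex_of_real (h t)) \<le> norm (C * t powr ?e)"
      by auto
  qed
qed

section \<open>Moments as integrals of tail measures\<close>

text \<open>
  After splitting off \<open>T powr w\<close>, both sides are \<open>w\<close> times an iterated integral of
  \<open>t powr (w - 1)\<close> over the region \<open>T < t \<le> g x\<close> of the product space.  Integrating its norm
  over \<open>x\<close> first gives the norm of the integrand in \<open>int\<close>, so the function is integrable on the
  product; Fubini then yields the equation and the integrability of the moment together.
  Keeping \<open>w\<close> as a factor, and never dividing by it, covers \<open>w = 0\<close> uniformly.
\<close>
lemma moment_eq_integral_tail_measure:
  fixes M :: "'a measure" and g :: "'a \<Rightarrow> real" and T :: real and w :: complex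
  defines "V \<equiv> \<lambda>t. measure M {x \<in> space M. t \<le> g x}"
  assumes "finite_measure M" and g[measurable]: "g \<in> borel_measurable M"
    and "T > 0" and ge: "\<And>x. x \<in> space M \<Longrightarrow> T \<le> g x"
    and int: "set_integrable lborel {T<..}
                (\<lambda>t. complex_of_real t powr (w - 1) * complex_of_real (V t))"
  shows "integrable M (\<lambda>x. complex_of_real (g x) powr w)" (is ?int)
    and "(LINT x|M. complex_of_real (g x) powr w)
           = complex_of_real T powr w * complex_of_real (measure M (space M))
             + w * (LINT t:{T<..}|lborel. complex_of_real t powr (w - 1) * complex_of_real (V t))"
      (is ?eq)
proof -
  interpret finite_measure M by fact
  interpret P: pair_sigma_finite lborel M ..
  define k where "k t = indicator {T<..} t *\<^sub>R (complex_of_real t powr (w - 1))" for t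
  have k[measurable]: "k \<in> borel_measurable borel"
    unfolding k_def by (rule borel_measurable_indicator_of_real_powr) fact
  \<comment> \<open>The condition \<open>T < t\<close> of the region is built into \<open>k\<close>, the condition \<open>t \<le> g x\<close> into \<open>F\<close>.\<close>
  define F where "F t x = indicator {x \<in> space M. t \<le> g x} x *\<^sub>R k t" for t x
  have F_measurable: "case_prod F \<in> borel_measurable (lborel \<Otimes>\<^sub>M M)"
  proof -
    have "(\<lambda>(t, x). if t \<le> g x then k t else 0) \<in> borel_measurable (lborel \<Otimes>\<^sub>M M)"
      by measurable
    then show ?thesis
      by (rule measurable_cong[THEN iffD1, rotated])
         (auto simp: F_def space_pair_measure indicator_def)
  qed
  have ind: "integrable M (indicat_real {x \<in> space M. t \<le> g x})" for t
    by (simp add: integrable_indicator_iff less_top[symmetric])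
  have ind_V: "(LINT x|M. indicat_real {x \<in> space M. t \<le> g x} x) = V t" for t
    by (simp add: V_def Int_absorb2 Collect_restrict)
  have slice: "integrable M (F t)" for t
    unfolding F_def using ind by (intro integrable_scaleR_left)
  have inner: "(LINT x|M. F t x) = V t *\<^sub>R k t" for t
    unfolding F_def using ind ind_V by (subst integral_scaleR_left) auto
  have inner_norm: "(LINT x|M. norm (F t x)) = norm (V t *\<^sub>R k t)" for t
    unfolding F_def norm_scaleR using ind_V by (simp add: V_def)
  have k_V: "V t *\<^sub>R k t = indicator {T<..} t *\<^sub>R
      (complex_of_real t powr (w - 1) * complex_of_real (V t))" for t
    by (simp add: k_def scaleR_conv_of_real)
  have int': "integrable lborel (\<lambda>t. V t *\<^sub>R k t)"
    using int unfolding set_integrable_def k_V .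
  have F_int: "integrable (lborel \<Otimes>\<^sub>M M) (case_prod F)"
  proof (rule P.Fubini_integrable[OF F_measurable])
    show "integrable lborel (\<lambda>t. LINT x|M. norm (case_prod F (t, x)))"
      using int' by (simp add: inner_norm del: norm_scaleR)
  qed (use slice in simp)
  have power: "complex_of_real (g x) powr w
      = complex_of_real T powr w + w * (LINT t|lborel. F t x)" if "x \<in> space M" for x
  proof -
    have "w * F t x = indicator {T<..g x} t *\<^sub>R (w * complex_of_real t powr (w - 1))" for t
      using that by (auto simp: F_def k_def indicator_def)
    then have "w * (LINT t|lborel. F t x)
        = (LINT t:{T<..g x}|lborel. w * complex_of_real t powr (w - 1))"
      unfolding set_lebesgue_integral_def integral_mult_right_zero[symmetric] by simp
    then show ?thesis
      using of_real_powr_FTC[OF \<open>T > 0\<close> ge[OF that], of w] by (simp only: add_diff_eq add_diff_cancel_left')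
  qed
  have outer: "integrable M (\<lambda>x. w * (LINT t|lborel. F t x))"
    using P.integrable_snd[OF F_int] by simp
  show ?int
    by (subst Bochner_Integration.integrable_cong[OF refl power]) (use outer in simp_all)
  have "(LINT x|M. complex_of_real (g x) powr w)
      = (LINT x|M. complex_of_real T powr w + w * (LINT t|lborel. F t x))"
    by (rule Bochner_Integration.integral_cong[OF refl power])
  also have "\<dots> = complex_of_real T powr w * complex_of_real (measure M (space M))
      + w * (LINT x|M. (LINT t|lborel. F t x))"
    using outer by (subst Bochner_Integration.integral_add) (auto simp: scaleR_conv_of_real)
  also have "(LINT x|M. (LINT t|lborel. F t x)) = (LINT t|lborel. (LINT x|M. F t x))"
    by (rule P.Fubini_integral[OF F_int])
  finally show ?eq
    unfolding inner k_V set_lebesgue_integral_def .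
qed

section \<open>Decay of tails and the functional equation\<close>

lemma tail_sets: "\<Omega> \<in> sets lebesgue \<Longrightarrow> tail t \<Omega> \<in> sets lebesgue"
  unfolding tail_def by (intro sets.Int) auto

text \<open>
  Vanishing upper content gives \<open>V t \<le> t powr p\<close> from some \<open>t1\<close> on; on the compact interval up to
  \<open>t1\<close> the function \<open>t powr p\<close> is bounded away from zero while \<open>V\<close> never exceeds the measure
  of \<open>\<Omega>\<close>, so enlarging the constant covers it.  Treating it through compactness avoids a
  distinction on the sign of the exponent.
\<close>
lemma tail_measure_powr_bound:
  fixes \<Omega> :: "(real ^ 'n::finite) set"
  assumes \<Omega>: "\<Omega> \<in> lmeasurable" and "T > 0"
    and r: "upper_minkowski_content_at_infinity r \<Omega> = 0"
  obtains C where "\<And>t. t > T \<Longrightarrow> measure lebesgue (tail t \<Omega>) \<le> C * t powr (real CARD('n) + r)"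
proof -
  let ?p = "real CARD('n) + r" and ?V = "\<lambda>t. measure lebesgue (tail t \<Omega>)"
  have lm: "tail t \<Omega> \<in> lmeasurable" for t
    using \<Omega> by (intro fmeasurableI2[OF \<Omega>] tail_sets) (auto simp: tail_def)
  have V_le: "?V t \<le> measure lebesgue \<Omega>" for t
    using \<Omega> lm by (intro measure_mono_fmeasurable) (auto simp: tail_def)
  have "\<forall>\<^sub>F t in at_top. emeasure lebesgue (tail t \<Omega>) / ennreal (t powr ?p) < 1"
    using r unfolding upper_minkowski_content_at_infinity_def by (intro Limsup_lessD) simp
  then obtain t0 where t0: "\<And>t. t \<ge> t0 \<Longrightarrow> emeasure lebesgue (tail t \<Omega>) / ennreal (t powr ?p) < 1"
    by (auto simp: eventually_at_top_linorder)
  define t1 where "t1 = max t0 T"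
  have "continuous_on {T..t1} (\<lambda>t. t powr (- ?p))"
    using \<open>T > 0\<close> by (intro continuous_intros) auto
  then have "bdd_above ((\<lambda>t. t powr (- ?p)) ` {T..t1})"
    by (intro bounded_imp_bdd_above compact_imp_bounded compact_continuous_image) auto
  then obtain K where K: "\<And>t. t \<in> {T..t1} \<Longrightarrow> t powr (- ?p) \<le> K"
    unfolding bdd_above_def by blast
  have K0: "K \<ge> 0"
    using K[of T] by (simp add: t1_def) (meson order_trans powr_ge_zero)
  show ?thesis
  proof
    fix t assume "t > T"
    then have t: "t > 0" "t powr ?p > 0" using \<open>T > 0\<close> by auto
    show "?V t \<le> (1 + measure lebesgue \<Omega> * K) * t powr ?p"
    proof (cases "t \<le> t1")
      case True
      have "1 = t powr (- ?p) * t powr ?p"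
        using t by (simp flip: powr_add)
      also have "\<dots> \<le> K * t powr ?p"
        using K[of t] True \<open>t > T\<close> by (intro mult_right_mono) auto
      finally have "measure lebesgue \<Omega> * 1 \<le> measure lebesgue \<Omega> * (K * t powr ?p)"
        by (rule mult_left_mono) simp
      then have "?V t \<le> measure lebesgue \<Omega> * K * t powr ?p"
        using V_le[of t] by (simp only: mult.assoc mult_1_right)
      also have "\<dots> \<le> (1 + measure lebesgue \<Omega> * K) * t powr ?p"
        by (intro mult_right_mono) auto
      finally show ?thesis .
    next
      case False
      then have "ennreal (?V t) / ennreal (t powr ?p) < 1"
        using t0[of t] lm[of t] by (simp add: t1_def emeasure_eq_measure2)
      then have "?V t / t powr ?p < 1"
        using t by (simp add: divide_ennreal ennreal_less_one_iff)
      then have "?V t \<le> t powr ?p"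
        using t by (simp add: field_simps)
      also have "\<dots> \<le> (1 + measure lebesgue \<Omega> * K) * t powr ?p"
        using t K0 by (simp add: algebra_simps)
      finally show ?thesis .
    qed
  qed
qed

theorem theorem3p1:
  fixes \<Omega> :: "(real ^ 'n::finite) set" and T :: real and s :: complex
  assumes "\<Omega> \<in> sets lebesgue"
    and "emeasure lebesgue \<Omega> < \<infinity>"
    and "T > 0"
    and "ereal (Re s) > upper_box_dim_at_infinity \<Omega>"
  shows "set_integrable lebesgue (tail T \<Omega>)
           (\<lambda>x. complex_of_real (norm x) powr (- s - of_nat CARD('n)))
       \<and> set_integrable lebesgue {T<..}
           (\<lambda>t. complex_of_real t powr (- s - of_nat CARD('n) - 1) *
                complex_of_real (measure lebesgue (tail t \<Omega>)))
       \<and> distance_zeta_at_infinity \<Omega> T s =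
           complex_of_real T powr (- s - of_nat CARD('n)) *
             complex_of_real (measure lebesgue (tail T \<Omega>))
           - (s + of_nat CARD('n)) * tube_zeta_at_infinity \<Omega> T s"
proof -
  define w where "w = - s - of_nat CARD('n)"
  define V where "V t = measure lebesgue (tail t \<Omega>)" for t
  define A where "A = tail T \<Omega>"
  have \<Omega>: "\<Omega> \<in> lmeasurable"
    using assms by (auto simp: fmeasurable_def)
  have lm: "tail t \<Omega> \<in> lmeasurable" for t
    by (intro fmeasurableI2[OF \<Omega>] tail_sets assms) (auto simp: tail_def)
  obtain r where r: "r < Re s" "upper_minkowski_content_at_infinity r \<Omega> = 0"
    using assms(4) unfolding upper_box_dim_at_infinity_def by (auto simp: Inf_less_iff)
  obtain C where C: "\<And>t. t > T \<Longrightarrow> V t \<le> C * t powr (real CARD('n) + r)"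
    using tail_measure_powr_bound[OF \<Omega> \<open>T > 0\<close> r(2)] unfolding V_def by blast
  have V_borel: "V \<in> borel_measurable borel"
  proof -
    have "mono (\<lambda>t. - V t)"
      unfolding V_def
      by (intro monoI le_imp_neg_le measure_mono_fmeasurable lm)
         (use lm in \<open>auto simp: tail_def fmeasurableD\<close>)
    then have "(\<lambda>t. - (- V t)) \<in> borel_measurable borel"
      by (intro borel_measurable_uminus borel_measurable_mono)
    then show ?thesis by simp
  qed
  have tube: "set_integrable lborel {T<..}
      (\<lambda>t. complex_of_real t powr (w - 1) * complex_of_real (V t))"
    using r(1) by (intro set_integrable_powr_mult_of_bound[OF \<open>T > 0\<close> _ V_borel _ C])
                  (auto simp: w_def V_def)
  have tube_leb: "set_integrable lebesgue {T<..}
      (\<lambda>t. complex_of_real t powr (w - 1) * complex_of_real (V t))"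
    and tube_eq: "(LINT t:{T<..}|lebesgue. complex_of_real t powr (w - 1) * complex_of_real (V t))
      = (LINT t:{T<..}|lborel. complex_of_real t powr (w - 1) * complex_of_real (V t))"
    using tube borel_measurable_integrable[OF tube[unfolded set_integrable_def]]
    unfolding set_integrable_def set_lebesgue_integral_def
    by (simp_all add: integrable_completion integral_completion)

  \<comment> \<open>The tail itself, with the restricted measure, serves as the finite measure space.  Its
    sets \<open>norm x \<ge> t\<close> are the smaller tails only for \<open>t \<ge> T\<close>, which is all that the integral
    over \<open>t > T\<close> sees.\<close>
  let ?M = "restrict_space lebesgue A"
  have A: "A \<in> sets lebesgue" and A_lm: "A \<in> lmeasurable"
    using lm by (auto simp: A_def fmeasurableD)
  have space: "space ?M = A"
    by (simp add: space_restrict_space)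
  have finite: "finite_measure ?M"
    using A_lm A by (intro finite_measureI) (simp add: space emeasure_restrict_space fmeasurable_def)
  have meas: "norm \<in> borel_measurable ?M"
    by (intro measurable_restrict_space1) (simp add: measurable_completion)
  have ge: "T \<le> norm x" if "x \<in> space ?M" for x
    using that by (auto simp: space A_def tail_def)
  have V_eq: "measure ?M {x \<in> space ?M. t \<le> norm x} = V t" if "t > T" for t
  proof -
    have "{x \<in> A. t \<le> norm x} = tail t \<Omega>"
      using that by (auto simp: A_def tail_def)
    moreover have "tail t \<Omega> \<subseteq> A"
      using that by (auto simp: A_def tail_def)
    ultimately show ?thesis
      using A by (simp add: space V_def measure_restrict_space)
  qed
  have tube_M: "set_integrable lborel {T<..} (\<lambda>t. complex_of_real t powr (w - 1) *
      complex_of_real (measure ?M {x \<in> space ?M. t \<le> norm x}))"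
    using tube by (rule set_integrable_cong[THEN iffD1, rotated -1]) (simp_all only: V_eq greaterThan_iff)
  have tube_M_eq: "(LINT t:{T<..}|lborel. complex_of_real t powr (w - 1) *
        complex_of_real (measure ?M {x \<in> space ?M. t \<le> norm x}))
      = (LINT t:{T<..}|lborel. complex_of_real t powr (w - 1) * complex_of_real (V t))"
    by (intro set_lebesgue_integral_cong allI impI) (simp, simp only: V_eq greaterThan_iff)
  note moment = moment_eq_integral_tail_measure[OF finite meas \<open>T > 0\<close> ge tube_M]
  have dist: "set_integrable lebesgue A (\<lambda>x. complex_of_real (norm x) powr w)"
    using moment(1) A by (simp add: set_integrable_def integrable_restrict_space)
  have "(LINT x:A|lebesgue. complex_of_real (norm x) powr w)
      = (LINT x|?M. complex_of_real (norm x) powr w)"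
    using A by (simp add: set_lebesgue_integral_def integral_restrict_space)
  also have "\<dots> = complex_of_real T powr w * complex_of_real (V T)
      + w * (LINT t:{T<..}|lebesgue. complex_of_real t powr (w - 1) * complex_of_real (V t))"
    using moment(2) A unfolding tube_M_eq tube_eq
    by (simp add: space measure_restrict_space V_def A_def)
  finally have eq: "(LINT x:A|lebesgue. complex_of_real (norm x) powr w)
      = complex_of_real T powr w * complex_of_real (V T)
        - (s + of_nat CARD('n)) *
          (LINT t:{T<..}|lebesgue. complex_of_real t powr (w - 1) * complex_of_real (V t))"
    by (simp add: w_def algebra_simps)
  show ?thesis
    using dist tube_leb eq
    unfolding distance_zeta_at_infinity_def tube_zeta_at_infinity_def w_def V_def A_def by blast
qed

end
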